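(* Let $R$ be a nonzero ring. The following statements are equivalent: (1) $R$ is a simple ring. (2) Every left $R$-module is prime.
   Context: Rings are associative with identity. A nonzero ring is simple if its only two-sided ideals are $0$ and $R$. A left $R$-module $M$ is prime (in the sense of Johnson) if $\mathrm{Ann}_R(M)=\mathrm{Ann}_R(N)$ for each nonzero submodule $N$ of $M$, where $\mathrm{Ann}_R(M)=\{r\in R: rM=0\}$; equivalently, for every nonzero submodule $K\le M$ and every two-sided ideal $I$ of $R$, $IK=0$ implies $IM=0$. With this definition the zero module is (vacuously) prime. *)

theory Defs
  imports "HOL-Algebra.Algebra"
begin

locale simple_ring = ring R for R (structure) +
  assumes nonzero: "carrier R \<noteq> {\<zero>}"
    and ideal_trivial: "\<And>I. ideal I R \<Longrightarrow> I = {\<zero>} \<or> I = carrier R"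

text \<open>The library locale \<^locale>\<open>module\<close> requires a commutative ring of scalars.  The following
  locale has the same axioms over an arbitrary ring.  As there, the ring multiplication and unit
  fields of the record \<open>M\<close> play no role.  The library's \<^locale>\<open>submodule\<close> does not presuppose
  commutativity and is used unchanged.\<close>

locale left_module = R?: ring R + M?: abelian_group M
  for R :: "('a, 'c) ring_scheme" (structure) and M :: "('a, 'b, 'd) module_scheme" (structure) +
  assumes smult_closed:
      "\<lbrakk>a \<in> carrier R; x \<in> carrier M\<rbrakk> \<Longrightarrow> a \<odot>\<^bsub>M\<^esub> x \<in> carrier M"
    and smult_l_distr:
      "\<lbrakk>a \<in> carrier R; b \<in> carrier R; x \<in> carrier M\<rbrakk> \<Longrightarrow>
        (a \<oplus> b) \<odot>\<^bsub>M\<^esub> x = a \<odot>\<^bsub>M\<^esub> x \<oplus>\<^bsub>M\<^esub> b \<odot>\<^bsub>M\<^esub> x"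
    and smult_r_distr:
      "\<lbrakk>a \<in> carrier R; x \<in> carrier M; y \<in> carrier M\<rbrakk> \<Longrightarrow>
        a \<odot>\<^bsub>M\<^esub> (x \<oplus>\<^bsub>M\<^esub> y) = a \<odot>\<^bsub>M\<^esub> x \<oplus>\<^bsub>M\<^esub> a \<odot>\<^bsub>M\<^esub> y"
    and smult_assoc:
      "\<lbrakk>a \<in> carrier R; b \<in> carrier R; x \<in> carrier M\<rbrakk> \<Longrightarrow>
        (a \<otimes> b) \<odot>\<^bsub>M\<^esub> x = a \<odot>\<^bsub>M\<^esub> (b \<odot>\<^bsub>M\<^esub> x)"
    and smult_one:
      "x \<in> carrier M \<Longrightarrow> \<one> \<odot>\<^bsub>M\<^esub> x = x"

definition annihilator ::
    "('a, 'c) ring_scheme \<Rightarrow> ('a, 'b, 'd) module_scheme \<Rightarrow> 'b set \<Rightarrow> 'a set"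
  where "annihilator R M N = {r \<in> carrier R. \<forall>x\<in>N. r \<odot>\<^bsub>M\<^esub> x = \<zero>\<^bsub>M\<^esub>}"

definition prime_module :: "('a, 'c) ring_scheme \<Rightarrow> ('a, 'b, 'd) module_scheme \<Rightarrow> bool"
  where "prime_module R M \<longleftrightarrow> left_module R M \<and>
    (\<forall>N. submodule N R M \<and> N \<noteq> {\<zero>\<^bsub>M\<^esub>} \<longrightarrow>
      annihilator R M (carrier M) = annihilator R M N)"

text \<open>HOL cannot quantify over types inside a formula, so "every left \<open>R\<close>-module" has to name the
  type in which the carriers live.  The predicate below does so through its \<open>itself\<close> argument.
  The type must not be too small for the implication from primeness of all modules to simplicity
  of \<open>R\<close>: over a one-element type, for instance, every module is zero.  The type
  \<^typ>\<open>'a \<times> 'a set\<close> accommodates, for every ideal \<open>I\<close>, the direct sum of \<open>R\<close> and \<open>R Quot I\<close>.\<close>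

definition all_left_modules_prime :: "('a, 'c) ring_scheme \<Rightarrow> 'm itself \<Rightarrow> bool"
  where "all_left_modules_prime R (_ :: 'm itself) \<longleftrightarrow>
    (\<forall>M :: ('a, 'm) module. left_module R M \<longrightarrow> prime_module R M)"

end

theory Submission
  imports Defs
begin

text \<open>
  The annihilator of a submodule is a two-sided ideal.  Over a simple ring it is therefore \<open>0\<close> or
  everything, and it can only be everything if \<open>\<one>\<close> kills the submodule, that is, if the submodule
  is zero.  So all nonzero submodules of a given module share the annihilator \<open>0\<close>, and the module
  is prime.

  Conversely, let \<open>I\<close> be a proper ideal.  The module \<open>R \<oplus> R/I\<close> is faithful because of its first
  summand, while its second summand is a nonzero submodule with annihilator \<open>I\<close>.  Primeness of
  this one module forces \<open>I = 0\<close>.  The product ring \<open>R \<times> R/I\<close> carries this module structure: the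
  scalars act through the ring homomorphism \<open>r \<mapsto> (r, r + I)\<close>.
\<close>

lemma (in left_module) smult_zero:
  assumes "a \<in> carrier R"
  shows "a \<odot>\<^bsub>M\<^esub> \<zero>\<^bsub>M\<^esub> = \<zero>\<^bsub>M\<^esub>"
proof -
  have "a \<odot>\<^bsub>M\<^esub> \<zero>\<^bsub>M\<^esub> \<oplus>\<^bsub>M\<^esub> a \<odot>\<^bsub>M\<^esub> \<zero>\<^bsub>M\<^esub> = a \<odot>\<^bsub>M\<^esub> \<zero>\<^bsub>M\<^esub>"
    using smult_r_distr[OF assms, of "\<zero>\<^bsub>M\<^esub>" "\<zero>\<^bsub>M\<^esub>"] by simp
  then show ?thesis
    using smult_closed[OF assms, of "\<zero>\<^bsub>M\<^esub>"] by (simp add: M.add.l_cancel_one)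
qed

lemma (in left_module) zero_smult:
  assumes "x \<in> carrier M"
  shows "\<zero> \<odot>\<^bsub>M\<^esub> x = \<zero>\<^bsub>M\<^esub>"
proof -
  have "\<zero> \<odot>\<^bsub>M\<^esub> x \<oplus>\<^bsub>M\<^esub> \<zero> \<odot>\<^bsub>M\<^esub> x = \<zero> \<odot>\<^bsub>M\<^esub> x"
    using smult_l_distr[OF _ _ assms, of \<zero> \<zero>] by simp
  then show ?thesis
    using smult_closed[OF _ assms, of \<zero>] by (simp add: M.add.l_cancel_one)
qed

lemma (in left_module) annihilator_uminus:
  assumes "r \<in> annihilator R M N" and "N \<subseteq> carrier M"
  shows "\<ominus> r \<in> annihilator R M N"
proof -
  have r: "r \<in> carrier R" using assms(1) by (simp add: annihilator_def)
  have "(\<ominus> r) \<odot>\<^bsub>M\<^esub> x = \<zero>\<^bsub>M\<^esub>" if "x \<in> N" for x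
  proof -
    have x: "x \<in> carrier M" and rx: "r \<odot>\<^bsub>M\<^esub> x = \<zero>\<^bsub>M\<^esub>"
      using assms that by (auto simp: annihilator_def)
    have "(\<ominus> r) \<odot>\<^bsub>M\<^esub> x = (\<ominus> r) \<odot>\<^bsub>M\<^esub> x \<oplus>\<^bsub>M\<^esub> r \<odot>\<^bsub>M\<^esub> x"
      using r x rx smult_closed[of "\<ominus> r" x] by simp
    also have "\<dots> = (\<ominus> r \<oplus> r) \<odot>\<^bsub>M\<^esub> x"
      using r x by (simp add: smult_l_distr)
    also have "\<dots> = \<zero>\<^bsub>M\<^esub>"
      using r x by (simp add: R.l_neg zero_smult)
    finally show ?thesis .
  qed
  with r show ?thesis by (simp add: annihilator_def)
qed

text \<open>Left multiples of an annihilating scalar annihilate any set; for right multiples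
  \<open>(a \<otimes> r) \<odot> x = a \<odot> (r \<odot> x)\<close> one needs \<open>r \<odot> x\<close> to lie in the set again.  It is this stability
  that makes the annihilator of a submodule two-sided.\<close>

lemma (in left_module) annihilator_submodule_ideal:
  assumes "submodule N R M"
  shows "ideal (annihilator R M N) R"
proof (rule idealI[OF R.ring_axioms])
  interpret N: submodule N R M by fact
  have N: "x \<in> carrier M" if "x \<in> N" for x
    using N.subset that by auto
  show "subgroup (annihilator R M N) (add_monoid R)"
  proof (rule R.add.subgroupI)
    show "annihilator R M N \<subseteq> carrier R" by (auto simp: annihilator_def)
    show "annihilator R M N \<noteq> {}"
      using N zero_smult by (auto simp: annihilator_def intro!: exI[of _ \<zero>])
    show "\<ominus> a \<in> annihilator R M N" if "a \<in> annihilator R M N" for a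
      using annihilator_uminus[OF that] N by blast
    show "a \<oplus> b \<in> annihilator R M N"
      if "a \<in> annihilator R M N" "b \<in> annihilator R M N" for a b
      using that N by (auto simp: annihilator_def smult_l_distr)
  qed
  show "x \<otimes> a \<in> annihilator R M N" if "a \<in> annihilator R M N" "x \<in> carrier R" for a x
    using that N by (auto simp: annihilator_def smult_assoc smult_zero)
  show "a \<otimes> x \<in> annihilator R M N" if "a \<in> annihilator R M N" "x \<in> carrier R" for a x
    using that N by (auto simp: annihilator_def smult_assoc)
qed

lemma simple_ring_annihilator_trivial:
  fixes R (structure) and M (structure)
  assumes "simple_ring R" and "left_module R M" and "submodule N R M" and "N \<noteq> {\<zero>\<^bsub>M\<^esub>}"
  shows "annihilator R M N = {\<zero>\<^bsub>R\<^esub>}"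
proof -
  interpret simple_ring R by fact
  interpret left_module R M by fact
  interpret N: submodule N R M by fact
  have "annihilator R M N \<noteq> carrier R"
  proof
    assume "annihilator R M N = carrier R"
    then have "\<one>\<^bsub>R\<^esub> \<in> annihilator R M N" by simp
    then have "x = \<zero>\<^bsub>M\<^esub>" if "x \<in> N" for x
      using that N.subset smult_one[of x] by (auto simp: annihilator_def)
    moreover have "\<zero>\<^bsub>M\<^esub> \<in> N" using N.one_closed by simp
    ultimately show False using assms(4) by blast
  qed
  then show ?thesis
    using ideal_trivial annihilator_submodule_ideal[OF assms(3)] by blast
qed

lemma simple_ring_imp_prime_module:
  assumes "simple_ring R" and "left_module R M"
  shows "prime_module R M"
proof -
  interpret left_module R M by fact
  have "annihilator R M (carrier M) = annihilator R M N"
    if N: "submodule N R M" "N \<noteq> {\<zero>\<^bsub>M\<^esub>}" for N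
  proof
    have "N \<subseteq> carrier M"
      using subgroup.subset[OF submodule.axioms(1)[OF N(1)]] by simp
    then show "annihilator R M (carrier M) \<subseteq> annihilator R M N"
      by (auto simp: annihilator_def)
    show "annihilator R M N \<subseteq> annihilator R M (carrier M)"
      using simple_ring_annihilator_trivial[OF assms N] zero_smult
      by (simp add: annihilator_def)
  qed
  with assms(2) show ?thesis by (simp add: prime_module_def)
qed

definition restrict_scalars :: "('a \<Rightarrow> 'b) \<Rightarrow> ('b, 'c) ring_scheme \<Rightarrow> ('a, 'b) module"
  where "restrict_scalars h S =
    \<lparr>carrier = carrier S, monoid.mult = (\<otimes>\<^bsub>S\<^esub>), one = \<one>\<^bsub>S\<^esub>, ring.zero = \<zero>\<^bsub>S\<^esub>, add = (\<oplus>\<^bsub>S\<^esub>),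
     smult = (\<lambda>r x. h r \<otimes>\<^bsub>S\<^esub> x)\<rparr>"

lemma restrict_scalars_simps [simp]:
  "carrier (restrict_scalars h S) = carrier S"
  "\<zero>\<^bsub>restrict_scalars h S\<^esub> = \<zero>\<^bsub>S\<^esub>"
  "x \<oplus>\<^bsub>restrict_scalars h S\<^esub> y = x \<oplus>\<^bsub>S\<^esub> y"
  "r \<odot>\<^bsub>restrict_scalars h S\<^esub> x = h r \<otimes>\<^bsub>S\<^esub> x"
  by (simp_all add: restrict_scalars_def)

lemma restrict_scalars_left_module:
  assumes "ring R" and "ring S" and "h \<in> ring_hom R S"
  shows "left_module R (restrict_scalars h S)"
proof -
  interpret R: ring R by fact
  interpret S: ring S by fact
  have h: "h r \<in> carrier S" if "r \<in> carrier R" for r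
    using ring_hom_closed[OF assms(3) that] .
  have "abelian_group (restrict_scalars h S)"
    by (rule abelian_groupI)
      (auto simp: S.a_ac intro: S.l_neg S.add.inv_closed)
  then show ?thesis
    using assms h
    by (auto intro!: left_module.intro left_module_axioms.intro
        simp: ring_hom_add ring_hom_mult ring_hom_one S.l_distr S.r_distr S.m_assoc)
qed

lemma RDirProd_simps:
  "carrier (RDirProd R S) = carrier R \<times> carrier S"
  "\<zero>\<^bsub>RDirProd R S\<^esub> = (\<zero>\<^bsub>R\<^esub>, \<zero>\<^bsub>S\<^esub>)"
  "\<one>\<^bsub>RDirProd R S\<^esub> = (\<one>\<^bsub>R\<^esub>, \<one>\<^bsub>S\<^esub>)"
  "(a, b) \<oplus>\<^bsub>RDirProd R S\<^esub> (c, d) = (a \<oplus>\<^bsub>R\<^esub> c, b \<oplus>\<^bsub>S\<^esub> d)"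
  "(a, b) \<otimes>\<^bsub>RDirProd R S\<^esub> (c, d) = (a \<otimes>\<^bsub>R\<^esub> c, b \<otimes>\<^bsub>S\<^esub> d)"
  by (auto simp: RDirProd_def DirProd_def monoid.defs)

lemma graph_ring_hom:
  assumes "f \<in> ring_hom R S"
  shows "(\<lambda>r. (r, f r)) \<in> ring_hom R (RDirProd R S)"
  using assms by (auto simp: ring_hom_def RDirProd_simps)

text \<open>The module below is \<open>R \<oplus> S\<close>, with \<open>R\<close> acting on \<open>S\<close> through \<open>f\<close>.  Its annihilator is \<open>0\<close>
  since \<open>r \<odot> (\<one>, \<zero>) = (r, \<zero>)\<close>, and the annihilator of the submodule \<open>0 \<oplus> S\<close> is the kernel of \<open>f\<close>
  since \<open>r \<odot> (\<zero>, s) = (\<zero>, f r \<otimes> s)\<close>.\<close>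

lemma prime_direct_sum_imp_trivial_kernel:
  fixes R (structure) and S (structure)
  assumes "ring R" and "ring S" and f: "f \<in> ring_hom R S"
    and prime: "prime_module R (restrict_scalars (\<lambda>r. (r, f r)) (RDirProd R S))"
    and nonzero: "carrier S \<noteq> {\<zero>\<^bsub>S\<^esub>}"
    and r: "r \<in> carrier R" "f r = \<zero>\<^bsub>S\<^esub>"
  shows "r = \<zero>\<^bsub>R\<^esub>"
proof -
  interpret R: ring R by fact
  interpret S: ring S by fact
  define M where "M = restrict_scalars (\<lambda>r. (r, f r)) (RDirProd R S)"
  interpret M: abelian_group M
    using prime by (simp add: prime_module_def left_module_def M_def)
  define N where "N = {\<zero>\<^bsub>R\<^esub>} \<times> carrier S"
  have fc: "f r \<in> carrier S" if "r \<in> carrier R" for r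
    using ring_hom_closed[OF f that] .
  have "subgroup N (add_monoid M)"
  proof (rule M.add.subgroupI)
    show "N \<subseteq> carrier M" by (auto simp: M_def N_def RDirProd_simps)
    show "N \<noteq> {}" by (auto simp: N_def)
    show "a \<oplus>\<^bsub>M\<^esub> b \<in> N" if "a \<in> N" "b \<in> N" for a b
      using that by (auto simp: M_def N_def RDirProd_simps)
    show "\<ominus>\<^bsub>M\<^esub> a \<in> N" if "a \<in> N" for a
    proof -
      obtain s where s: "s \<in> carrier S" "a = (\<zero>\<^bsub>R\<^esub>, s)"
        using \<open>a \<in> N\<close> by (auto simp: N_def)
      have "\<ominus>\<^bsub>M\<^esub> a = (\<zero>\<^bsub>R\<^esub>, \<ominus>\<^bsub>S\<^esub> s)"
        by (rule M.minus_equality) (use s in \<open>auto simp: M_def RDirProd_simps S.l_neg\<close>)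
      with s show ?thesis by (simp add: N_def)
    qed
  qed
  then have "submodule N R M"
    by (intro submodule.intro submodule_axioms.intro)
      (auto simp: M_def N_def RDirProd_simps fc)
  moreover have "N \<noteq> {\<zero>\<^bsub>M\<^esub>}"
    using nonzero by (auto simp: M_def N_def RDirProd_simps)
  ultimately have "annihilator R M (carrier M) = annihilator R M N"
    using prime by (simp add: prime_module_def M_def)
  moreover have "r \<in> annihilator R M N"
    using r by (auto simp: annihilator_def M_def N_def RDirProd_simps)
  ultimately have "r \<in> annihilator R M (carrier M)" by simp
  moreover have "(\<one>\<^bsub>R\<^esub>, \<zero>\<^bsub>S\<^esub>) \<in> carrier M" by (simp add: M_def RDirProd_simps)
  ultimately have "r \<odot>\<^bsub>M\<^esub> (\<one>\<^bsub>R\<^esub>, \<zero>\<^bsub>S\<^esub>) = \<zero>\<^bsub>M\<^esub>" by (simp add: annihilator_def)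
  then show ?thesis using r by (simp add: M_def RDirProd_simps)
qed

lemma all_left_modules_prime_imp_simple_ring:
  fixes R :: "('a, 'c) ring_scheme" (structure)
  assumes "ring R" and "carrier R \<noteq> {\<zero>}"
    and prime: "all_left_modules_prime R TYPE('a \<times> 'a set)"
  shows "simple_ring R"
proof -
  interpret R: ring R by fact
  have "I = {\<zero>} \<or> I = carrier R" if "ideal I R" for I
  proof (rule disjCI)
    assume proper: "I \<noteq> carrier R"
    interpret I: ideal I R by fact
    have zero_Quot: "\<zero>\<^bsub>R Quot I\<^esub> = I" by (simp add: FactRing_def)
    have coset: "I +> r \<in> carrier (R Quot I)" if "r \<in> carrier R" for r
      using ring_hom_closed[OF I.rcos_ring_hom that] .
    have "I +> \<one> \<noteq> I"
      using I.a_rcos_self[OF R.one_closed] I.one_imp_carrier proper by blast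
    then have nonzero: "carrier (R Quot I) \<noteq> {\<zero>\<^bsub>R Quot I\<^esub>}"
      using coset[OF R.one_closed] zero_Quot by auto
    have "left_module R (restrict_scalars (\<lambda>r. (r, I +> r)) (RDirProd R (R Quot I)))"
      by (intro restrict_scalars_left_module graph_ring_hom RDirProd_ring
          I.rcos_ring_hom I.quotient_is_ring R.ring_axioms)
    then have "prime_module R (restrict_scalars (\<lambda>r. (r, I +> r)) (RDirProd R (R Quot I)))"
      using prime by (simp add: all_left_modules_prime_def)
    then have "r = \<zero>" if "r \<in> I" for r
      using prime_direct_sum_imp_trivial_kernel[OF assms(1) I.quotient_is_ring
          I.rcos_ring_hom _ nonzero, of r] that I.a_rcos_const[OF that] zero_Quot by simp
    then show "I = {\<zero>}" using I.zero_closed by auto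
  qed
  with assms show ?thesis
    by (simp add: simple_ring_def simple_ring_axioms_def)
qed

theorem theorem4p3:
  fixes R :: "('a, 'c) ring_scheme" (structure)
  assumes "ring R"
    and "carrier R \<noteq> {\<zero>}"
  shows "(simple_ring R \<longleftrightarrow> all_left_modules_prime R TYPE('a \<times> 'a set)) \<and>
         (simple_ring R \<longrightarrow> all_left_modules_prime R TYPE('m))"
  using all_left_modules_prime_imp_simple_ring[OF assms]
  by (auto simp: all_left_modules_prime_def intro: simple_ring_imp_prime_module)

end
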